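(* For all $z\in\mathbb{C}$ and all real $-1\le x<\tfrac12$, $$F(z,x)=\log(1-x)-\sum_{n=1}^{\infty}\left(\frac{-x}{1-x}\right)^n\frac{1}{n}\binom{n+z}{n},$$ $$F(z,x)=\log(1-x)+F\!\left(-z-1,\frac{-x}{1-x}\right),$$ and, for $-\tfrac12<x\le 1$, $$F\!\left(z,\frac{x}{1+x}\right)=-\log(1+x)+F(-z-1,-x).$$
   Context: For $z\in\mathbb{C}$ and $|x|<1$, and for $x=\pm1$ whenever the series converges, $F(z,x)=\sum_{n=1}^{\infty}\binom{z}{n}\frac{(-1)^{n-1}x^n}{n}$, where $\binom{z}{n}=\frac{z(z-1)\cdots(z-n+1)}{n!}$; in particular $\binom{n+z}{n}=\frac{(z+1)(z+2)\cdots(z+n)}{n!}$. *)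

theory Defs
  imports "HOL-Analysis.Analysis"
begin

text \<open>
  The series defining \<open>F(z,x)\<close> starts at \<open>n = 1\<close>; its terms are therefore indexed here by
  \<open>n = Suc k\<close>, with sign \<open>(-1)\<^sup>n\<^sup>-\<^sup>1 = (-1)\<^sup>k\<close>.
\<close>

definition F_term :: "complex \<Rightarrow> complex \<Rightarrow> nat \<Rightarrow> complex" where
  "F_term z x k = (z gchoose Suc k) * ((-1) ^ k * x ^ Suc k / of_nat (Suc k))"

text \<open>
  \<open>F z x\<close> is meaningful for \<open>norm x < 1\<close>, and for \<open>x = 1\<close> or \<open>x = -1\<close> when
  \<open>summable (F_term z x)\<close>; elsewhere its value is an artefact of \<^const>\<open>suminf\<close> being total.
\<close>

definition F :: "complex \<Rightarrow> complex \<Rightarrow> complex" where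
  "F z x = (\<Sum>k. F_term z x k)"

end

theory Submission imports Defs begin

text \<open>
  By the binomial series, \<open>F(z,w)\<close> has derivative \<open>(1 - (1-w)\<^sup>z) / w\<close> in the unit disc. The map
  \<open>w \<mapsto> -w/(1-w)\<close> sends the half plane \<open>Re w < 1/2\<close> to the unit disc, so on the convex set where
  both \<open>F(z,w)\<close> and \<open>F(-z-1,-w/(1-w))\<close> are analytic the two sides can be compared by their
  derivatives, as they agree at \<open>0\<close>. The endpoint \<open>w = -1\<close> follows from Abel's limit theorem, and
  the first and third formulas from upper negation of binomials and from substituting
  \<open>-x\<close> for \<open>x\<close> and \<open>-z-1\<close> for \<open>z\<close>.
\<close>

section \<open>Abel's limit theorem in a Banach space\<close>

lemma Abel_limit:
  fixes a :: "nat \<Rightarrow> 'a::banach"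
  assumes a: "summable a"
  shows "((\<lambda>r::real. \<Sum>n. r ^ n *\<^sub>R a n) \<longlongrightarrow> suminf a) (at_left 1)"
proof -
  \<comment> \<open>Summation by parts against the shifted partial sums \<open>S n\<close>, which tend to \<open>0\<close>\<close>
  define S where "S n = (\<Sum>k\<le>n. a k) - suminf a" for n
  have S0: "S \<longlonglongrightarrow> 0"
    unfolding S_def using summable_LIMSEQ'[OF a] by (simp add: LIM_zero)
  then obtain C where C: "\<And>n. norm (S n) \<le> C" and "C > 0"
    by (metis Bseq_def convergent_imp_Bseq convergentI)
  have sumS: "summable (\<lambda>n. norm (r ^ n *\<^sub>R S n))" if "0 \<le> r" "r < 1" for r :: real
    by (rule summable_comparison_test'[where g = "\<lambda>n. C * r ^ n" and N = 0])
      (use that C in \<open>auto intro!: summable_mult summable_geometric mult_right_mono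
        simp: mult.commute[of _ "norm _"]\<close>)
  have Abel: "(\<Sum>n. r ^ n *\<^sub>R a n) - suminf a = (1 - r) *\<^sub>R (\<Sum>n. r ^ n *\<^sub>R S n)"
    if r: "0 \<le> r" "r < 1" for r :: real
  proof -
    have s: "(\<lambda>n. r ^ n *\<^sub>R S n) sums (\<Sum>n. r ^ n *\<^sub>R S n)"
      using summable_norm_cancel[OF sumS[OF r]] by (rule summable_sums)
    \<comment> \<open>At \<open>Suc m\<close> this is \<open>r ^ Suc m *\<^sub>R S m\<close>, so
      subtracting it from the \<open>S\<close> series leaves the increments
      \<open>S n - S (n - 1) = a n\<close> with weight \<open>r ^ n\<close>.\<close>
    let ?shift = "\<lambda>n. case n of 0 \<Rightarrow> 0 | Suc m \<Rightarrow> r *\<^sub>R (r ^ m *\<^sub>R S m)"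
    have "?shift sums (r *\<^sub>R (\<Sum>n. r ^ n *\<^sub>R S n) + ?shift 0)"
      by (rule sums_Suc) (simp only: nat.case, rule sums_scaleR_right[OF s])
    then have "?shift sums (r *\<^sub>R (\<Sum>n. r ^ n *\<^sub>R S n))"
      by (simp only: nat.case add_0_right)
    from sums_diff[OF s this]
    have "(\<lambda>n. r ^ n *\<^sub>R S n - ?shift n)
        sums ((1 - r) *\<^sub>R (\<Sum>n. r ^ n *\<^sub>R S n))"
      by (simp add: algebra_simps)
    \<comment> \<open>Since \<open>S 0 = a 0 - suminf a\<close>, the term of index 0 has to be
      corrected by \<open>suminf a\<close>.\<close>
    moreover have "(\<lambda>n. if n = 0 then suminf a else 0) sums suminf a"
      using sums_single[of 0 "\<lambda>_. suminf a"] by simp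
    ultimately have "(\<lambda>n. r ^ n *\<^sub>R S n - ?shift n
          + (if n = 0 then suminf a else 0))
        sums ((1 - r) *\<^sub>R (\<Sum>n. r ^ n *\<^sub>R S n) + suminf a)"
      by (rule sums_add)
    also have "(\<lambda>n. r ^ n *\<^sub>R S n - ?shift n
          + (if n = 0 then suminf a else 0)) = (\<lambda>n. r ^ n *\<^sub>R a n)"
      by (auto simp: fun_eq_iff S_def algebra_simps split: nat.split)
    finally show ?thesis by (simp add: sums_iff)
  qed
  have "((\<lambda>r::real. (1 - r) *\<^sub>R (\<Sum>n. r ^ n *\<^sub>R S n)) \<longlongrightarrow> 0) (at_left 1)"
  proof (rule tendstoI)
    fix e :: real assume e: "e > 0"
    then obtain N where N: "\<And>n. n \<ge> N \<Longrightarrow> norm (S n) < e / 2"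
      using LIMSEQ_D[OF S0, of "e / 2"] by auto
    have bound: "norm ((1 - r) *\<^sub>R (\<Sum>n. r ^ n *\<^sub>R S n)) \<le> (1 - r) * (N * C) + e / 2"
      if r: "0 \<le> r" "r < 1" for r :: real
    proof -
      \<comment> \<open>The first \<open>N\<close> terms are bounded by \<open>C\<close>, the later
        ones by \<open>e / 2 * r ^ n\<close>. After multiplication by \<open>1 - r\<close> the
        geometric part gives exactly \<open>e / 2\<close>, and the rest vanishes as \<open>r\<close>
        tends to 1.\<close>
      let ?b = "\<lambda>n. (if n < N then C else 0) + e / 2 * r ^ n"
      have b: "?b sums (N * C + e / 2 * (1 / (1 - r)))"
      proof (intro sums_add sums_mult)
        show "(\<lambda>n. if n < N then C else 0) sums (N * C)"
          using sums_If_finite_set[of "{..<N}" "\<lambda>_. C"] by simp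
        show "(^) r sums (1 / (1 - r))" using r by (intro geometric_sums) auto
      qed
      have le: "norm (r ^ n *\<^sub>R S n) \<le> ?b n" for n
      proof (cases "n < N")
        case True
        have "r ^ n * norm (S n) \<le> 1 * C"
          using r C \<open>C > 0\<close> by (intro mult_mono) (auto simp: power_le_one)
        moreover have "0 \<le> e / 2 * r ^ n" using e r by simp
        ultimately show ?thesis using True r by simp
      next
        case False
        then show ?thesis
          using mult_right_mono[of "norm (S n)" "e / 2" "r ^ n"] N[of n] r
          by (simp add: mult.commute)
      qed
      have "norm (\<Sum>n. r ^ n *\<^sub>R S n) \<le> N * C + e / 2 * (1 / (1 - r))"
        using summable_norm[OF sumS[OF r]] suminf_le[OF le sumS[OF r] sums_summable[OF b]] b
        by (simp add: sums_iff)
      then have "(1 - r) * norm (\<Sum>n. r ^ n *\<^sub>R S n) \<le> (1 - r) * (N * C + e / 2 * (1 / (1 - r)))"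
        using r by (intro mult_left_mono) auto
      also have "\<dots> = (1 - r) * (N * C) + e / 2"
        using r by (simp add: field_simps)
      finally show ?thesis using r by simp
    qed
    have "((\<lambda>r::real. (1 - r) * (N * C) + e / 2) \<longlongrightarrow> (1 - 1) * (N * C) + e / 2) (at_left 1)"
      by (intro tendsto_intros)
    then have "\<forall>\<^sub>F r in at_left (1::real). (1 - r) * (N * C) + e / 2 < e"
      by (rule order_tendstoD) (use e in simp)
    moreover have "\<forall>\<^sub>F r in at_left (1::real). 0 < r \<and> r < 1"
      using eventually_at_left_real[of 0 "1::real"] by simp
    ultimately show "\<forall>\<^sub>F r in at_left (1::real). dist ((1 - r) *\<^sub>R (\<Sum>n. r ^ n *\<^sub>R S n)) 0 < e"
    proof eventually_elim
      case (elim r)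
      then show ?case using bound[of r] unfolding dist_norm diff_zero by linarith
    qed
  qed
  moreover have "\<forall>\<^sub>F r in at_left (1::real).
      (1 - r) *\<^sub>R (\<Sum>n. r ^ n *\<^sub>R S n) = (\<Sum>n. r ^ n *\<^sub>R a n) - suminf a"
    using eventually_at_left_real[of 0 "1::real"] by (auto elim!: eventually_mono simp: Abel)
  ultimately have "((\<lambda>r. (\<Sum>n. r ^ n *\<^sub>R a n) - suminf a) \<longlongrightarrow> 0) (at_left 1)"
    by (rule Lim_transform_eventually)
  then show ?thesis by (rule LIM_zero_cancel)
qed

section \<open>Power series of \<open>F\<close> and its derivative in the unit disc\<close>

text \<open>The junk value \<open>x / 0 = 0\<close> makes the zeroth coefficient vanish.\<close>

definition F_coeff :: "complex \<Rightarrow> nat \<Rightarrow> complex" where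
  "F_coeff z n = (z gchoose n) * (-1) ^ (n - 1) / of_nat n"

lemma F_term_eq: "F_term z x k = F_coeff z (Suc k) * x ^ Suc k"
  by (simp add: F_term_def F_coeff_def)

text \<open>Dividing by \<open>n\<close> only shrinks the terms of the binomial series, whose radius
  of convergence is at least 1.\<close>

lemma summable_F_coeff:
  assumes "norm x < 1"
  shows "summable (\<lambda>n. F_coeff z n * x ^ n)"
proof (rule summable_comparison_test')
  show "summable (\<lambda>n. norm ((z gchoose n) * x ^ n))"
    by (rule abs_summable_in_conv_radius) (use assms in \<open>auto simp: conv_radius_gchoose\<close>)
  show "norm (F_coeff z n * x ^ n) \<le> norm ((z gchoose n) * x ^ n)" if "n \<ge> 0" for n
  proof (cases n)
    case (Suc m)
    have "norm (F_coeff z n * x ^ n) = norm ((z gchoose n) * x ^ n) / real n"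
      by (simp add: F_coeff_def norm_mult norm_divide norm_power)
    also have "\<dots> \<le> norm ((z gchoose n) * x ^ n) / 1"
      using Suc by (intro divide_left_mono) auto
    finally show ?thesis by simp
  qed (simp add: F_coeff_def)
qed

lemma summable_F_term: "norm x < 1 \<Longrightarrow> summable (F_term z x)"
  unfolding F_term_eq[abs_def] using summable_F_coeff[of x z] by (subst summable_Suc_iff)

lemma F_eq_powser: "norm x < 1 \<Longrightarrow> F z x = (\<Sum>n. F_coeff z n * x ^ n)"
  using suminf_split_head[OF summable_F_coeff[of x z]]
  by (simp add: F_def F_term_eq F_coeff_def)

text \<open>The quotient \<open>(1 - (1 - x) powr z) / x\<close> as a power series, which fills the
  removable singularity at 0 with the correct value \<open>z\<close>.\<close>

definition F_deriv :: "complex \<Rightarrow> complex \<Rightarrow> complex" where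
  "F_deriv z x = (\<Sum>n. (z gchoose Suc n) * (-1) ^ n * x ^ n)"

lemma has_field_derivative_F:
  assumes "norm x < 1"
  shows "(F z has_field_derivative F_deriv z x) (at x)"
proof -
  have "diffs (F_coeff z) = (\<lambda>n. (z gchoose Suc n) * (-1) ^ n)"
    by (simp add: diffs_def F_coeff_def fun_eq_iff del: of_nat_Suc)
  with termdiffs_strong'[OF summable_F_coeff[of _ z] assms]
  have "((\<lambda>x. \<Sum>n. F_coeff z n * x ^ n) has_field_derivative F_deriv z x) (at x)"
    by (simp add: F_deriv_def)
  \<comment> \<open>The power series is known to equal \<open>F z\<close> only inside the disc, so
    the derivative is transferred along a neighbourhood of \<open>x\<close>.\<close>
  then show ?thesis
    by (rule DERIV_cong_ev[THEN iffD1, rotated -1, OF _ refl _ refl])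
      (use assms in \<open>auto intro!: eventually_mono[OF eventually_nhds_in_open[of "ball 0 1"]]
         simp: F_eq_powser\<close>)
qed

lemma F_deriv_0: "F_deriv z 0 = z"
  unfolding F_deriv_def by (subst powser_zero) simp

text \<open>This is the binomial series at \<open>-x\<close> without its constant term 1, with a
  factor \<open>-x\<close> pulled out.\<close>

lemma mult_F_deriv:
  assumes "norm x < 1"
  shows "x * F_deriv z x = 1 - (1 - x) powr z"
proof -
  have "(\<lambda>n. (z gchoose n) * (-x) ^ n) sums (1 - x) powr z"
    using gen_binomial_complex[of "-x" z] assms by simp
  then have s: "(\<lambda>n. (z gchoose Suc n) * (-x) ^ Suc n) sums ((1 - x) powr z - 1)"
    by (subst sums_Suc_iff) simp
  have eq: "(z gchoose Suc n) * (-x) ^ Suc n = - x * ((z gchoose Suc n) * (-1) ^ n * x ^ n)" for n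
    by (simp add: power_minus[of x n])
  show ?thesis
  proof (cases "x = 0")
    case False
    have "summable (\<lambda>n. (z gchoose Suc n) * (-1) ^ n * x ^ n)"
      using sums_summable[OF s] False unfolding eq
      by (simp only: summable_cmult_iff neg_equal_0_iff_equal simp_thms)
    then have "(\<lambda>n. - x * ((z gchoose Suc n) * (-1) ^ n * x ^ n)) sums (- x * F_deriv z x)"
      unfolding F_deriv_def by (intro sums_mult summable_sums)
    with s have "(1 - x) powr z - 1 = - x * F_deriv z x"
      unfolding eq by (rule sums_unique2)
    then show ?thesis by (simp add: algebra_simps)
  qed simp
qed

section \<open>The transformation formula inside the disc\<close>

text \<open>The points with real part below 1/2 are those closer to 0 than to 1.\<close>

lemma norm_moebius_less_1:
  fixes w :: complex
  assumes "Re w < 1 / 2"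
  shows "norm (- w / (1 - w)) < 1"
proof -
  have "(norm w)\<^sup>2 < (norm (1 - w))\<^sup>2"
    unfolding cmod_power2 using assms by (simp add: power2_eq_square algebra_simps)
  then have "norm w < norm (1 - w)" by (rule power2_less_imp_less) simp
  then show ?thesis by (simp add: norm_divide divide_less_eq)
qed

text \<open>The left side is the derivative of the difference of the two sides of
  \<open>F_moebius\<close>. Away from 0 both values of \<open>F_deriv\<close> are rational in
  \<open>w\<close> and \<open>P\<close>, and the sum cancels.\<close>

lemma F_deriv_moebius:
  assumes "norm w < 1" "Re w < 1 / 2"
  shows "F_deriv z w + 1 / (1 - w) + F_deriv (- z - 1) (- w / (1 - w)) / (1 - w)\<^sup>2 = 0"
    (is "?A + _ + ?B / _ = 0")
\<comment> \<open>At 0 the product formula \<open>mult_F_deriv\<close> says nothing; there the sum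
  is \<open>z + 1 + (- z - 1)\<close>.\<close>
proof (cases "w = 0")
  case True
  then show ?thesis by (simp add: F_deriv_0)
next
  case False
  define P where "P = (1 - w) powr z"
  have w1: "1 - w \<noteq> 0" using assms by auto
  \<comment> \<open>The real part of \<open>1 - w\<close> is positive, so the branch cut is avoided
    and the principal logarithm changes sign under inversion.\<close>
  have "1 - w \<notin> \<real>\<^sub>\<le>\<^sub>0" using assms by (auto simp: complex_nonpos_Reals_iff)
  then have Ln: "Ln (inverse (1 - w)) = - Ln (1 - w)" by (rule Ln_inverse)
  have "1 - (- w / (1 - w)) = inverse (1 - w)" using w1 by (simp add: field_simps)
  then have "(1 - (- w / (1 - w))) powr (- z - 1) = exp ((z + 1) * Ln (1 - w))"
    using w1 Ln by (simp add: powr_def algebra_simps)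
  also have "\<dots> = P * (1 - w)"
    using w1 by (simp add: P_def powr_def algebra_simps exp_add)
  finally have "(- w / (1 - w)) * ?B = 1 - P * (1 - w)"
    using mult_F_deriv[OF norm_moebius_less_1[OF assms(2)], of "- z - 1"] by simp
  then have B: "?B = (P * (1 - w) - 1) * (1 - w) / w"
    using w1 False by (simp add: field_simps)
  have "w * ?A = 1 - P" using mult_F_deriv[OF assms(1)] by (simp add: P_def)
  then have A: "?A = (1 - P) / w" using False by (simp add: field_simps)
  show ?thesis unfolding A B using w1 False
    by (simp add: divide_simps power2_eq_square) (simp add: algebra_simps)
qed

lemma F_moebius:
  assumes "norm w < 1" "Re w < 1 / 2"
  shows "F z w = Ln (1 - w) + F (- z - 1) (- w / (1 - w))"
proof -
  define G where "G w = F z w - Ln (1 - w) - F (- z - 1) (- w / (1 - w))" for w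
  define D :: "complex set" where "D = ball 0 1 \<inter> {w. Re w < 1 / 2}"
  have "\<exists>c. \<forall>w\<in>D. G w = c"
  proof (rule has_field_derivative_zero_constant)
    show "convex D" unfolding D_def by (intro convex_Int convex_halfspace_Re_lt convex_ball)
    fix w assume "w \<in> D"
    then have w: "norm w < 1" "Re w < 1 / 2" by (auto simp: D_def)
    then have w1: "1 - w \<noteq> 0" by auto
    have "1 - w \<notin> \<real>\<^sub>\<le>\<^sub>0" using w by (auto simp: complex_nonpos_Reals_iff)
    then have L: "((\<lambda>w. Ln (1 - w)) has_field_derivative - 1 / (1 - w)) (at w)"
      by (auto intro!: derivative_eq_intros simp: inverse_eq_divide)
    have y: "((\<lambda>w. - w / (1 - w)) has_field_derivative - 1 / (1 - w)\<^sup>2) (at w)"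
      using w1 by (auto intro!: derivative_eq_intros simp: power2_eq_square field_simps)
    have "(G has_field_derivative F_deriv z w - (- 1 / (1 - w)) -
        F_deriv (- z - 1) (- w / (1 - w)) * (- 1 / (1 - w)\<^sup>2)) (at w)"
      unfolding G_def
      by (intro DERIV_diff has_field_derivative_F w L y norm_moebius_less_1
          DERIV_chain2[where f = "F (- z - 1)"])
    then show "(G has_field_derivative 0) (at w within D)"
      using F_deriv_moebius[OF w, of z] by (simp add: has_field_derivative_at_within)
  qed
  moreover have "w \<in> D" "0 \<in> D" using assms by (auto simp: D_def)
  ultimately have "G w = G 0" by metis
  also have "G 0 = 0" by (simp add: G_def F_def F_term_def)
  finally show ?thesis by (simp add: G_def diff_eq_eq add.commute)
qed

section \<open>The endpoint -1 and real arguments\<close>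

lemma F_left_limit_minus_1:
  assumes "summable (F_term z (- 1))"
  shows "((\<lambda>r. F z (complex_of_real (- r))) \<longlongrightarrow> F z (- 1)) (at_left 1)"
proof -
  \<comment> \<open>The series of \<open>F\<close> starts with the first power of \<open>x\<close>,
    so Abel's sum is short of one factor \<open>r\<close>, which tends to 1.\<close>
  have "((\<lambda>r. r *\<^sub>R (\<Sum>n. r ^ n *\<^sub>R F_term z (- 1) n)) \<longlongrightarrow> 1 *\<^sub>R F z (- 1)) (at_left 1)"
    unfolding F_def by (intro tendsto_intros Abel_limit assms)
  moreover have "\<forall>\<^sub>F r in at_left (1::real).
      r *\<^sub>R (\<Sum>n. r ^ n *\<^sub>R F_term z (- 1) n) = F z (complex_of_real (- r))"
    using eventually_at_left_real[of 0 "1::real"]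
  proof (rule eventually_mono, simp)
    fix r :: real assume r: "r \<in> {0<..<1}"
    have eq: "F_term z (complex_of_real (- r)) n = r *\<^sub>R (r ^ n *\<^sub>R F_term z (- 1) n)" for n
      by (simp add: F_term_def scaleR_conv_of_real power_minus[of "complex_of_real r"])
    have "summable (\<lambda>n. r *\<^sub>R (r ^ n *\<^sub>R F_term z (- 1) n))"
      unfolding eq[symmetric] using r by (intro summable_F_term) simp
    then have "summable (\<lambda>n. inverse r *\<^sub>R (r *\<^sub>R (r ^ n *\<^sub>R F_term z (- 1) n)))"
      by (rule summable_scaleR_right)
    then have "summable (\<lambda>n. r ^ n *\<^sub>R F_term z (- 1) n)"
      using r by (simp flip: mult.assoc)
    then show "r *\<^sub>R (\<Sum>n. r ^ n *\<^sub>R F_term z (- 1) n) = F z (complex_of_real (- r))"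
      unfolding F_def eq by (rule suminf_scaleR_right)
  qed
  ultimately show ?thesis by (simp add: Lim_transform_eventually)
qed

lemma F_moebius_real:
  fixes x :: real
  assumes x: "- 1 \<le> x" "x < 1 / 2" and conv: "x = - 1 \<Longrightarrow> summable (F_term z (- 1))"
  shows "F z (complex_of_real x) = complex_of_real (ln (1 - x)) +
    F (- z - 1) (complex_of_real (- x / (1 - x)))"
proof -
  have open_case: "F z (complex_of_real x) = complex_of_real (ln (1 - x)) +
      F (- z - 1) (complex_of_real (- x / (1 - x)))" if "- 1 < x" "x < 1 / 2" for x :: real
    using F_moebius[of "complex_of_real x" z] Ln_of_real[of "1 - x"] that by simp
  show ?thesis
  proof (cases "x = - 1")
    case False
    with x open_case show ?thesis by simp
  next
    case True
    \<comment> \<open>The right side at \<open>x = - r\<close>. As \<open>r\<close> tends to 1, the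
      argument of \<open>F\<close> tends to 1/2, inside the disc, so \<open>?R\<close> is continuous
      there and only the left side requires Abel's theorem.\<close>
    let ?R = "\<lambda>r. complex_of_real (ln (1 + r)) + F (- z - 1) (complex_of_real (r / (1 + r)))"
    have "isCont (F (- z - 1)) (complex_of_real (1 / (1 + 1)))"
      by (rule DERIV_isCont[OF has_field_derivative_F]) simp
    then have "(?R \<longlongrightarrow> ?R 1) (at_left 1)"
      by (intro tendsto_intros isCont_tendsto_compose[of _ "F (- z - 1)"]) auto
    moreover have "\<forall>\<^sub>F r in at_left (1::real). ?R r = F z (complex_of_real (- r))"
      using eventually_at_left_real[of 0 "1::real"]
    proof (rule eventually_mono, simp)
      fix r :: real assume "r \<in> {0<..<1}"
      then show "?R r = F z (complex_of_real (- r))"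
        using open_case[of "- r"] by simp
    qed
    ultimately have "((\<lambda>r. F z (complex_of_real (- r))) \<longlongrightarrow> ?R 1) (at_left 1)"
      by (rule Lim_transform_eventually)
    with F_left_limit_minus_1[OF conv[OF True]] have "F z (- 1) = ?R 1"
      by (intro tendsto_unique) auto
    then show ?thesis using True by simp
  qed
qed

text \<open>Upper negation contributes \<open>(- 1) ^ Suc k\<close>, which meets the sign
  \<open>(- 1) ^ k\<close> of \<open>F_term\<close> and leaves a constant minus.\<close>

lemma F_term_upper_negation:
  "F_term (- z - 1) y k =
    - (y ^ Suc k * (1 / of_nat (Suc k)) * ((of_nat (Suc k) + z) gchoose Suc k))"
proof -
  have "(- z - 1) gchoose Suc k = (- 1) ^ Suc k * ((of_nat (Suc k) + z) gchoose Suc k)"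
    using gbinomial_minus'[of z "Suc k"] gbinomial_minus[of "z + 1" "Suc k"]
    by (simp only: minus_add_distrib add_ac diff_conv_add_uminus add_diff_cancel) simp
  moreover have "(- 1) ^ k * (- 1) ^ k = (1::complex)"
    by (simp flip: power_mult_distrib)
  ultimately show ?thesis by (simp add: F_term_def)
qed

text \<open>The summability conjuncts ensure that every \<open>suminf\<close> in the formulas is a
  genuine sum; at the endpoints, convergence of the series at -1 is assumed.\<close>

theorem theorem5:
  fixes z :: complex
  shows
    "(\<forall>x::real. - 1 \<le> x \<and> x < 1 / 2 \<and> (x = - 1 \<longrightarrow> summable (F_term z (- 1))) \<longrightarrow>
        (let y = complex_of_real (- x / (1 - x));
             t = (\<lambda>k. y ^ Suc k * (1 / of_nat (Suc k)) * ((of_nat (Suc k) + z) gchoose Suc k))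
         in summable (F_term z (complex_of_real x)) \<and> summable t \<and> summable (F_term (- z - 1) y) \<and>
            F z (complex_of_real x) = complex_of_real (ln (1 - x)) - (\<Sum>k. t k) \<and>
            F z (complex_of_real x) = complex_of_real (ln (1 - x)) + F (- z - 1) y)) \<and>
     (\<forall>x::real. - 1 / 2 < x \<and> x \<le> 1 \<and> (x = 1 \<longrightarrow> summable (F_term (- z - 1) (- 1))) \<longrightarrow>
        summable (F_term z (complex_of_real (x / (1 + x)))) \<and>
        summable (F_term (- z - 1) (complex_of_real (- x))) \<and>
        F z (complex_of_real (x / (1 + x))) =
          - complex_of_real (ln (1 + x)) + F (- z - 1) (complex_of_real (- x)))"
proof -
  have summable_x: "summable (F_term z (complex_of_real x))"
    if "- 1 \<le> x" "x < 1 / 2" "x = - 1 \<longrightarrow> summable (F_term z (- 1))" for z and x :: real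
    using that by (cases "x = - 1") (auto intro: summable_F_term)
  have summable_y: "summable (F_term z (complex_of_real (- x / (1 - x))))"
    if "x < 1 / 2" for z and x :: real
    using norm_moebius_less_1[of "complex_of_real x"] that by (intro summable_F_term) simp
  show ?thesis
  proof (intro conjI allI impI)
    fix x :: real
    assume x: "- 1 \<le> x \<and> x < 1 / 2 \<and> (x = - 1 \<longrightarrow> summable (F_term z (- 1)))"
    define y where "y = complex_of_real (- x / (1 - x))"
    define t where
      "t k = y ^ Suc k * (1 / of_nat (Suc k)) * ((of_nat (Suc k) + z) gchoose Suc k)" for k
    have t: "F_term (- z - 1) y = (\<lambda>k. - t k)"
      by (simp add: fun_eq_iff F_term_upper_negation t_def)
    have sy: "summable (F_term (- z - 1) y)" using summable_y x by (simp add: y_def)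
    then have "summable t" unfolding t by (simp add: summable_minus_iff)
    moreover from this have "F (- z - 1) y = - (\<Sum>k. t k)"
      unfolding F_def t by (rule suminf_minus)
    moreover have "F z (complex_of_real x) = complex_of_real (ln (1 - x)) + F (- z - 1) y"
      unfolding y_def using x by (intro F_moebius_real) auto
    ultimately show "let y = complex_of_real (- x / (1 - x));
             t = (\<lambda>k. y ^ Suc k * (1 / of_nat (Suc k)) * ((of_nat (Suc k) + z) gchoose Suc k))
         in summable (F_term z (complex_of_real x)) \<and> summable t \<and> summable (F_term (- z - 1) y) \<and>
            F z (complex_of_real x) = complex_of_real (ln (1 - x)) - (\<Sum>k. t k) \<and>
            F z (complex_of_real x) = complex_of_real (ln (1 - x)) + F (- z - 1) y"
      using summable_x[of x z] x sy
      unfolding Let_def y_def[symmetric] t_def[symmetric] by simp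
  next
    fix x :: real
    assume x: "- 1 / 2 < x \<and> x \<le> 1 \<and> (x = 1 \<longrightarrow> summable (F_term (- z - 1) (- 1)))"
    show "summable (F_term z (complex_of_real (x / (1 + x))))"
      using summable_y[of "- x" z] x by simp
    show "summable (F_term (- z - 1) (complex_of_real (- x)))"
      using x by (intro summable_x) auto
    \<comment> \<open>The map sending \<open>z\<close> to \<open>- z - 1\<close> is an involution,
      so the second formula at \<open>- x\<close> and \<open>- z - 1\<close> has
      \<open>F z (x / (1 + x))\<close> on its right side and is solved for it.\<close>
    show "F z (complex_of_real (x / (1 + x))) =
        - complex_of_real (ln (1 + x)) + F (- z - 1) (complex_of_real (- x))"
      using F_moebius_real[of "- x" "- z - 1"] x by simp
  qed
qed

end
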